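(* Let $k_1,k_2\ge 1$ be integers. The probability mass function $f_{q,S}(n;\theta)=P_{q,\theta}(W_S=n)$ satisfies, for all $n\ge \min(k_1,k_2)$, $$f_{q,S}(n;\theta)=f^{(1)}_{q,S}(n;\theta)+f^{(0)}_{q,S}(n;\theta),$$ where $f^{(1)}_{q,S}(k_1;\theta)=\theta^{k_1}$, $f^{(0)}_{q,S}(k_2;\theta)=\prod_{j=1}^{k_2}(1-\theta q^{j-1})$, for $n>k_1$ $$f^{(1)}_{q,S}(n;\theta)=\sum_{i=1}^{n-k_1}\theta^{n-i}q^{ik_1}\prod_{j=1}^{i}(1-\theta q^{j-1})\sum_{s=1}^{i}\Big[A_q^{k_1,k_2}(n-k_1-i,i,s)+B_q^{k_1,k_2}(n-k_1-i,i,s)\Big],$$ and for $n>k_2$ $$f^{(0)}_{q,S}(n;\theta)=\sum_{i=1}^{n-k_2}\theta^{n-k_2-i}\prod_{j=1}^{i+k_2}(1-\theta q^{j-1})\sum_{s=1}^{n-k_2-i}\Big[C_q^{k_1,k_2}(n-k_2-i,i,s)+D_q^{k_1,k_2}(n-k_2-i,i,s)\Big].$$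
   Context: Model: fix reals $0\le\theta\le1$ and $0<q<1$. $(X_j)_{j\ge1}$ is a sequence of $\{0,1\}$-valued random variables (1 = success, 0 = failure) with law $P_{q,\theta}$ such that, conditionally on $X_1,\dots,X_{j-1}$ containing exactly $i-1$ zeros, $X_j=0$ with probability $1-\theta q^{i-1}$ and $X_j=1$ with probability $\theta q^{i-1}$. Conventions: $0^0=1$, empty products are 1, empty sums are 0. Waiting times: $T_1$ is the least $n$ with $n\ge k_1$ and $X_{n-k_1+1}=\dots=X_n=1$; $T_0$ is the least $n$ with $n\ge k_2$ and $X_{n-k_2+1}=\dots=X_n=0$ (each is $\infty$ if no such $n$ exists). $W_S=\min(T_1,T_0)$ is the sooner waiting time; $f^{(1)}_{q,S}(n;\theta)=P_{q,\theta}(T_1=n,\ T_0>n)$ is the probability that the first run of $k_1$ consecutive successes is completed at trial $n$ and no failure run of length $k_2$ or more has appeared before; $f^{(0)}_{q,S}(n;\theta)=P_{q,\theta}(T_0=n,\ T_1>n)$ is the probability that the first run of $k_2$ consecutive failures is completed at trial $n$ and no success run of length $k_1$ or more has appeared before. Combinatorial sums, for integers $m,r$ and $s\ge1$, where all $x_j,y_j$ are integers with $0<x_j<k_1$, $0<y_j<k_2$ (a family of zero variables consists of the single empty tuple, whose sum is $0$): - $A_q^{k_1,k_2}(m,r,s)=\sum q^{\sum_{j=1}^{s-1}(y_1+\dots+y_j)x_j}$ over $(x_1,\dots,x_{s-1})$, $(y_1,\dots,y_s)$ with $\sum x_j=m$, $\sum y_j=r$; - $B_q^{k_1,k_2}(m,r,s)=\sum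 q^{\sum_{j=2}^{s}(y_1+\dots+y_{j-1})x_j}$ over $(x_1,\dots,x_s)$, $(y_1,\dots,y_s)$ with $\sum x_j=m$, $\sum y_j=r$; - $C_q^{k_1,k_2}(m,r,s)=\sum q^{\sum_{j=2}^{s}(y_1+\dots+y_{j-1})x_j}$ over $(x_1,\dots,x_s)$, $(y_1,\dots,y_{s-1})$ with $\sum x_j=m$, $\sum y_j=r$; - $D_q^{k_1,k_2}(m,r,s)=\sum q^{\sum_{j=1}^{s}(y_1+\dots+y_j)x_j}$ over $(x_1,\dots,x_s)$, $(y_1,\dots,y_s)$ with $\sum x_j=m$, $\sum y_j=r$.
   Formalization: In the formula for f^(0)(n;θ), n>k_2, the outer sum starts at i=0 instead of i=1; as printed it fails, e.g. k_1=2, k_2=1, n=2, where f^(0)=θ(1-θ) but the printed sum is 0; the i=0 term vanishes for n≥k_1+k_2. *)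

theory Defs
  imports "HOL-Probability.Probability"
begin

text \<open>Trials are indexed from 1 (\<open>X 0\<close> plays no role); success is 1 and failure is 0.  The law is
  determined by conditioning on the complete history \<open>X\<^sub>1 = x\<^sub>1, \<dots>, X\<^sub>j\<^sub>-\<^sub>1 = x\<^sub>j\<^sub>-\<^sub>1\<close>; the exponent
  \<open>z\<close> is the number of zeros in that history, i.e. \<open>z = i - 1\<close> while waiting for the \<open>i\<close>-th
  failure.  Null histories are excluded because conditional probabilities given them carry no
  information (they are 0 by division by zero).\<close>

definition q_bernoulli_process ::
    "'a measure \<Rightarrow> (nat \<Rightarrow> 'a \<Rightarrow> nat) \<Rightarrow> real \<Rightarrow> real \<Rightarrow> bool" where
  "q_bernoulli_process M X q \<theta> \<longleftrightarrow>
     prob_space M \<and>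
     (\<forall>j\<ge>1. X j \<in> measurable M (count_space {0, 1})) \<and>
     (\<forall>j\<ge>1. \<forall>x :: nat \<Rightarrow> nat. \<forall>z.
        \<P>(\<omega> in M. \<forall>l\<in>{1..<j}. X l \<omega> = x l) > 0 \<longrightarrow>
        card {l \<in> {1..<j}. x l = 0} = z \<longrightarrow>
        \<P>(\<omega> in M. X j \<omega> = 0 \<bar> \<forall>l\<in>{1..<j}. X l \<omega> = x l) = 1 - \<theta> * q ^ z \<and>
        \<P>(\<omega> in M. X j \<omega> = 1 \<bar> \<forall>l\<in>{1..<j}. X l \<omega> = x l) = \<theta> * q ^ z)"

text \<open>The infimum of the empty set in \<^typ>\<open>enat\<close> is \<open>\<infinity>\<close>.\<close>

definition first_run :: "nat \<Rightarrow> nat \<Rightarrow> (nat \<Rightarrow> nat) \<Rightarrow> enat" where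
  "first_run b k x = (INF n\<in>{n. n \<ge> k \<and> (\<forall>l\<in>{n - k + 1..n}. x l = b)}. enat n)"

definition T1 :: "(nat \<Rightarrow> 'a \<Rightarrow> nat) \<Rightarrow> nat \<Rightarrow> 'a \<Rightarrow> enat" where
  "T1 X k1 \<omega> = first_run 1 k1 (\<lambda>j. X j \<omega>)"

definition T0 :: "(nat \<Rightarrow> 'a \<Rightarrow> nat) \<Rightarrow> nat \<Rightarrow> 'a \<Rightarrow> enat" where
  "T0 X k2 \<omega> = first_run 0 k2 (\<lambda>j. X j \<omega>)"

definition WS :: "(nat \<Rightarrow> 'a \<Rightarrow> nat) \<Rightarrow> nat \<Rightarrow> nat \<Rightarrow> 'a \<Rightarrow> enat" where
  "WS X k1 k2 \<omega> = min (T1 X k1 \<omega>) (T0 X k2 \<omega>)"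

definition fS :: "'a measure \<Rightarrow> (nat \<Rightarrow> 'a \<Rightarrow> nat) \<Rightarrow> nat \<Rightarrow> nat \<Rightarrow> nat \<Rightarrow> real" where
  "fS M X k1 k2 n = \<P>(\<omega> in M. WS X k1 k2 \<omega> = enat n)"

definition fS1 :: "'a measure \<Rightarrow> (nat \<Rightarrow> 'a \<Rightarrow> nat) \<Rightarrow> nat \<Rightarrow> nat \<Rightarrow> nat \<Rightarrow> real" where
  "fS1 M X k1 k2 n = \<P>(\<omega> in M. T1 X k1 \<omega> = enat n \<and> T0 X k2 \<omega> > enat n)"

definition fS0 :: "'a measure \<Rightarrow> (nat \<Rightarrow> 'a \<Rightarrow> nat) \<Rightarrow> nat \<Rightarrow> nat \<Rightarrow> nat \<Rightarrow> real" where
  "fS0 M X k1 k2 n = \<P>(\<omega> in M. T0 X k2 \<omega> = enat n \<and> T1 X k1 \<omega> > enat n)"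

text \<open>A tuple \<open>(x\<^sub>1, \<dots>, x\<^sub>t)\<close> with \<open>0 < x\<^sub>j < k\<close> is an extensional function on \<open>{1..t}\<close>, so every
  tuple is counted once and there is exactly one empty tuple.  The sums encode alternating blocks of
  \<open>x\<^sub>j\<close> successes and \<open>y\<^sub>j\<close> failures: \<open>A\<close> and \<open>B\<close> end with a failure block and begin with a failure
  resp. success block; \<open>C\<close> and \<open>D\<close> end with a success block and begin with a success resp. failure
  block.\<close>

definition qA :: "real \<Rightarrow> nat \<Rightarrow> nat \<Rightarrow> nat \<Rightarrow> nat \<Rightarrow> nat \<Rightarrow> real" where
  "qA q k1 k2 m r s =
     (\<Sum>(x, y)\<in>{(x, y). x \<in> {1..s - 1} \<rightarrow>\<^sub>E {0<..<k1} \<and> y \<in> {1..s} \<rightarrow>\<^sub>E {0<..<k2} \<and>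
                     (\<Sum>j=1..s - 1. x j) = m \<and> (\<Sum>j=1..s. y j) = r}.
        q ^ (\<Sum>j=1..s - 1. (\<Sum>l=1..j. y l) * x j))"

definition qB :: "real \<Rightarrow> nat \<Rightarrow> nat \<Rightarrow> nat \<Rightarrow> nat \<Rightarrow> nat \<Rightarrow> real" where
  "qB q k1 k2 m r s =
     (\<Sum>(x, y)\<in>{(x, y). x \<in> {1..s} \<rightarrow>\<^sub>E {0<..<k1} \<and> y \<in> {1..s} \<rightarrow>\<^sub>E {0<..<k2} \<and>
                     (\<Sum>j=1..s. x j) = m \<and> (\<Sum>j=1..s. y j) = r}.
        q ^ (\<Sum>j=2..s. (\<Sum>l=1..j - 1. y l) * x j))"

text \<open>For \<open>r = 0\<close> (no failure before the closing failure run) the sum \<open>C\<close> does not vanish: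
  \<open>C m 0 1 = 1\<close> for \<open>0 < m < k1\<close>, from \<open>m\<close> successes and the empty tuple of failure blocks.  Hence
  the sum over \<open>i\<close> in the formula for \<^const>\<open>fS0\<close> has to start at \<open>i = 0\<close>; starting it at \<open>i = 1\<close>
  loses the outcomes consisting of \<open>m\<close> successes followed directly by \<open>k2\<close> failures.\<close>

definition qC :: "real \<Rightarrow> nat \<Rightarrow> nat \<Rightarrow> nat \<Rightarrow> nat \<Rightarrow> nat \<Rightarrow> real" where
  "qC q k1 k2 m r s =
     (\<Sum>(x, y)\<in>{(x, y). x \<in> {1..s} \<rightarrow>\<^sub>E {0<..<k1} \<and> y \<in> {1..s - 1} \<rightarrow>\<^sub>E {0<..<k2} \<and>
                     (\<Sum>j=1..s. x j) = m \<and> (\<Sum>j=1..s - 1. y j) = r}.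
        q ^ (\<Sum>j=2..s. (\<Sum>l=1..j - 1. y l) * x j))"

definition qD :: "real \<Rightarrow> nat \<Rightarrow> nat \<Rightarrow> nat \<Rightarrow> nat \<Rightarrow> nat \<Rightarrow> real" where
  "qD q k1 k2 m r s =
     (\<Sum>(x, y)\<in>{(x, y). x \<in> {1..s} \<rightarrow>\<^sub>E {0<..<k1} \<and> y \<in> {1..s} \<rightarrow>\<^sub>E {0<..<k2} \<and>
                     (\<Sum>j=1..s. x j) = m \<and> (\<Sum>j=1..s. y j) = r}.
        q ^ (\<Sum>j=1..s. (\<Sum>l=1..j. y l) * x j))"

end

theory Submission
  imports Defs
begin

text \<open>The outcomes of the first \<open>n\<close> trials form a binary word, and the probability of such a word
depends only on three numbers: if it has \<open>m\<close> successes and \<open>r\<close> failures, it is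
\<open>\<theta>\<^sup>m (\<Prod>j=1..r. 1 - \<theta> q\<^sup>j\<^sup>-\<^sup>1) q\<^sup>e\<close>, where \<open>e\<close> counts the pairs consisting of a failure and a later
success (lemmas \<open>prob_history\<close> and \<open>weight_eq\<close>).

The waiting time for a run of \<open>k\<close> letters \<open>c\<close> equals \<open>n\<close>, with no long run of the other letter so
far, exactly when the word consists of an earlier part in which all runs are short and which does
not end in \<open>c\<close>, followed by exactly \<open>k\<close> letters \<open>c\<close> (\<open>completed_run_iff\<close>).  So both waiting
time probabilities are sums, over the number of failures in the earlier part, of an explicit factor
times the generating function of \<open>q\<^sup>e\<close> over words with short runs (\<open>prob_completed_run\<close>).

It remains to see that these generating functions are the sums \<open>A + B\<close> and \<open>C + D\<close>.  Such a word
is an alternating sequence of blocks, and the four sums classify it by its first and last block.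
Instead of setting up this bijection globally, one removes the last block.  On the side of the words
this gives a mutual recursion between words ending in a failure and words ending in a success
(\<open>sum_short_run_words_strip\<close>); on the side of the sums it expresses \<open>A\<close> by \<open>D\<close>, \<open>B\<close> by \<open>C\<close>, \<open>C\<close>
by \<open>B\<close> and \<open>D\<close> by \<open>A\<close> (\<open>qA_Suc\<close> to \<open>qD_Suc\<close>).  Both recursions agree: a last block of \<open>a\<close>
successes after \<open>r\<close> failures contributes \<open>q\<^sup>r\<^sup>a\<close>, a last block of failures contributes \<open>1\<close>.
Induction on the length then gives \<open>sum_inversions_block_sums\<close>.\<close>
section \<open>Histories and runs\<close>

text \<open>The latest trial comes first, so that passing to the next trial is a \<open>Cons\<close> and structural recursion
on the word follows the process.  Consequently a prefix of the list is a final stretch of trials, and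
the head of the list is the last outcome.\<close>
definition history :: "(nat \<Rightarrow> nat) \<Rightarrow> nat \<Rightarrow> nat list" where
  "history x n = map x (rev [1..<Suc n])"

primrec run_free :: "nat \<Rightarrow> nat \<Rightarrow> nat list \<Rightarrow> bool" where
  "run_free c k [] \<longleftrightarrow> True"
| "run_free c k (a # u) \<longleftrightarrow> take k (a # u) \<noteq> replicate k c \<and> run_free c k u"

lemma history_0 [simp]: "history x 0 = []"
  by (simp add: history_def)

lemma history_Suc [simp]: "history x (Suc n) = x (Suc n) # history x n"
  by (simp add: history_def)

lemma length_history [simp]: "length (history x n) = n"
  by (simp add: history_def)

lemma history_nth: "i < n \<Longrightarrow> history x n ! i = x (n - i)"
  by (induction n arbitrary: i) (auto simp: nth_Cons split: nat.split)

text \<open>The left side is the condition that defines \<^const>\<open>first_run\<close>.\<close>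
lemma run_at_iff_history:
  "k \<le> n \<and> (\<forall>l\<in>{n - k + 1..n}. x l = c) \<longleftrightarrow> take k (history x n) = replicate k c"
proof -
  have "take k (history x n) = replicate k c \<longleftrightarrow> k \<le> n \<and> (\<forall>i<k. x (n - i) = c)"
    by (auto simp: list_eq_iff_nth_eq history_nth)
  also have "\<dots> \<longleftrightarrow> k \<le> n \<and> (\<forall>l\<in>{n - k + 1..n}. x l = c)"
  proof (intro conj_cong refl iffI)
    assume k: "k \<le> n" and *: "\<forall>i<k. x (n - i) = c"
    show "\<forall>l\<in>{n - k + 1..n}. x l = c"
    proof
      fix l assume "l \<in> {n - k + 1..n}"
      then have "n - l < k" "n - (n - l) = l" using k by auto
      then show "x l = c" using * by metis
    qed
  next
    assume "k \<le> n" "\<forall>l\<in>{n - k + 1..n}. x l = c"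
    then show "\<forall>i<k. x (n - i) = c" by auto
  qed
  finally show ?thesis by simp
qed

lemma run_free_history:
  assumes "k \<ge> 1"
  shows "run_free c k (history x n) \<longleftrightarrow> (\<forall>n'\<le>n. take k (history x n') \<noteq> replicate k c)"
proof (induction n)
  case 0
  then show ?case using assms by (cases k) auto
next
  case (Suc n)
  then show ?case by (auto simp: le_Suc_eq simp del: take_Suc_Cons)
qed

lemma first_run_gt_iff:
  assumes "k \<ge> 1"
  shows "enat n < first_run c k x \<longleftrightarrow> run_free c k (history x n)"
proof -
  have "enat n < first_run c k x \<longleftrightarrow> enat (Suc n) \<le> first_run c k x"
    by (simp add: Suc_ile_eq)
  also have "\<dots> \<longleftrightarrow> (\<forall>n'. take k (history x n') = replicate k c \<longrightarrow> Suc n \<le> n')"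
    unfolding first_run_def run_at_iff_history by (simp add: le_INF_iff)
  also have "\<dots> \<longleftrightarrow> (\<forall>n'\<le>n. take k (history x n') \<noteq> replicate k c)"
    by (meson not_less_eq_eq)
  finally show ?thesis using run_free_history[OF assms] by simp
qed

text \<open>Reaching \<open>Suc n\<close> means exceeding \<open>n\<close> but not \<open>Suc n\<close>, so this follows from the strict
comparison, and no minimum has to be computed.\<close>
lemma first_run_eq_iff:
  assumes "k \<ge> 1"
  shows "first_run c k x = enat (Suc n) \<longleftrightarrow>
    run_free c k (history x n) \<and> take k (history x (Suc n)) = replicate k c"
proof -
  have "first_run c k x = enat (Suc n) \<longleftrightarrow>
      enat n < first_run c k x \<and> \<not> enat (Suc n) < first_run c k x"
    by (cases "first_run c k x") auto
  then show ?thesis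
    using first_run_gt_iff[OF assms] by (auto simp del: take_Suc_Cons)
qed

lemma run_free_replicate_other:
  assumes "c \<noteq> d" "k \<ge> 1"
  shows "run_free c k (replicate b d @ u) \<longleftrightarrow> run_free c k u"
  using assms by (induction b) (cases k; auto)+

lemma take_replicate_append_eq:
  assumes "u = [] \<or> hd u \<noteq> c"
  shows "take k (replicate b c @ u) = replicate k c \<longleftrightarrow> k \<le> b"
proof (induction k arbitrary: b)
  case (Suc k)
  then show ?case using assms by (cases b; cases u) auto
qed simp

text \<open>Because \<open>u\<close> does not start with \<open>c\<close>, the new block does not merge with an old run, so a run of
length \<open>k\<close> appears only through the block itself.\<close>
lemma run_free_replicate_same:
  assumes "u = [] \<or> hd u \<noteq> c" "k \<ge> 1"
  shows "run_free c k (replicate b c @ u) \<longleftrightarrow> b < k \<and> run_free c k u"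
proof (induction b)
  case 0
  then show ?case using assms by auto
next
  case (Suc b)
  show ?case
    using Suc take_replicate_append_eq[OF assms(1), of k "Suc b"] by auto
qed

text \<open>If the part \<open>u\<close> before the completing block started with \<open>c\<close>, then a run of length \<open>k\<close> would have
been complete one trial earlier.  This is what excludes \<open>hd u = c\<close>.\<close>
lemma completed_run_iff:
  assumes "c \<noteq> d" "k \<ge> 1" "l \<ge> 1"
  shows "take k (a # w) = replicate k c \<and> run_free c k w \<and> run_free d l (a # w) \<longleftrightarrow>
    (\<exists>u. a # w = replicate k c @ u \<and> run_free c k u \<and> run_free d l u \<and> (u = [] \<or> hd u \<noteq> c))"
    (is "?L \<longleftrightarrow> ?R")
proof
  assume L: ?L
  obtain k' where k: "k = Suc k'" using assms(2) by (cases k) auto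
  define u where "u = drop k (a # w)"
  have aw: "a # w = replicate k c @ u"
    using L append_take_drop_id[of k "a # w"] unfolding u_def by argo
  then have w: "w = replicate k' c @ u" and a: "a = c" using k by auto
  have u: "u = [] \<or> hd u \<noteq> c"
  proof (rule ccontr)
    assume "\<not> ?thesis"
    then obtain u' where "u = c # u'" by (cases u) auto
    then have "w = replicate k c @ u'"
      by (simp add: w k replicate_app_Cons_same)
    then have "\<not> run_free c k w"
      by (simp add: k)
    with L show False by simp
  qed
  have "run_free c k u" using L u assms by (simp add: w run_free_replicate_same)
  moreover have "run_free d l u"
    using L run_free_replicate_other[of d c l k u] assms by (simp only: aw)
  ultimately show ?R using aw u by blast
next
  assume ?R
  then obtain u where aw: "a # w = replicate k c @ u" and
    u: "run_free c k u" "run_free d l u" "u = [] \<or> hd u \<noteq> c" by blast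
  obtain k' where k: "k = Suc k'" using assms(2) by (cases k) auto
  have w: "w = replicate k' c @ u" using aw k by simp
  have "run_free c k w" unfolding w using u assms k by (simp add: run_free_replicate_same)
  moreover have "run_free d l (a # w)"
    unfolding aw using u assms by (subst run_free_replicate_other) auto
  moreover have "take k (a # w) = replicate k c" unfolding aw by simp
  ultimately show ?L by blast
qed

section \<open>The law of a history\<close>

primrec weight :: "real \<Rightarrow> real \<Rightarrow> nat list \<Rightarrow> real" where
  "weight q \<theta> [] = 1"
| "weight q \<theta> (a # u) =
     (if a = 0 then 1 - \<theta> * q ^ count_list u 0 else \<theta> * q ^ count_list u 0) * weight q \<theta> u"

text \<open>Counts the pairs of a failure and a later success; in list order the success stands to the left.\<close>
primrec inversions :: "nat list \<Rightarrow> nat" where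
  "inversions [] = 0"
| "inversions (a # u) = (if a = 0 then 0 else count_list u 0) + inversions u"

lemma weight_eq:
  assumes "u \<in> lists {0, 1}"
  shows "weight q \<theta> u = \<theta> ^ count_list u 1 *
    (\<Prod>j=1..count_list u 0. 1 - \<theta> * q ^ (j - 1)) * q ^ inversions u"
  using assms by (induction u) (auto simp: power_add prod.atLeast1_atMost_eq)

lemma ex_history: "length u = n \<Longrightarrow> \<exists>x. history x n = u"
proof (induction u arbitrary: n)
  case (Cons a u)
  then obtain x where x: "history x (length u) = u" by blast
  have "history (x(Suc (length u) := a)) (length u) = history x (length u)"
    by (simp add: history_def)
  then have "history (x(Suc (length u) := a)) n = a # u" using x Cons.prems by auto
  then show ?case by blast
qed auto

text \<open>Together with \<open>ex_history\<close> and \<open>card_zeros_history\<close>, this translates between words and the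
histories given by a function, in terms of which the conditional laws of the process are stated.\<close>
lemma history_eq_iff: "history x n = history y n \<longleftrightarrow> (\<forall>l\<in>{1..<Suc n}. x l = y l)"
  by (auto simp: history_def)

lemma card_zeros_history: "card {l \<in> {1..<Suc n}. x l = 0} = count_list (history x n) 0"
proof (induction n)
  case (Suc n)
  have "{l \<in> {1..<Suc (Suc n)}. x l = 0} =
      (if x (Suc n) = 0 then insert (Suc n) {l \<in> {1..<Suc n}. x l = 0}
       else {l \<in> {1..<Suc n}. x l = 0})"
    by (auto simp: less_Suc_eq)
  then show ?case using Suc by auto
qed simp

lemma history_measurable:
  assumes "q_bernoulli_process M X q \<theta>"
  shows "{\<omega> \<in> space M. history (\<lambda>j. X j \<omega>) n = w} \<in> sets M"
proof (induction n arbitrary: w)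
  case 0
  then show ?case by (cases w) auto
next
  case (Suc n)
  have [measurable]: "X (Suc n) \<in> measurable M (count_space {0, 1})"
    using assms by (auto simp: q_bernoulli_process_def)
  have X: "{\<omega> \<in> space M. X (Suc n) \<omega> = a} \<in> sets M" for a
    by measurable
  show ?case
  proof (cases w)
    case (Cons a u)
    have "{\<omega> \<in> space M. history (\<lambda>j. X j \<omega>) (Suc n) = w} =
       {\<omega> \<in> space M. X (Suc n) \<omega> = a} \<inter> {\<omega> \<in> space M. history (\<lambda>j. X j \<omega>) n = u}"
      using Cons by auto
    then show ?thesis using X Suc by simp
  qed simp
qed

text \<open>The chain rule, by induction on the number of trials.  A history of probability zero carries no
conditional law, but then both sides vanish, because the weight contains the weight of the shorter
history as a factor.\<close>
lemma prob_history:
  assumes proc: "q_bernoulli_process M X q \<theta>"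
    and "w \<in> lists {0, 1}" "length w = n"
  shows "\<P>(\<omega> in M. history (\<lambda>j. X j \<omega>) n = w) = weight q \<theta> w"
  using assms(2,3)
proof (induction w arbitrary: n)
  case Nil
  interpret prob_space M using proc by (simp add: q_bernoulli_process_def)
  show ?case using Nil by (simp add: prob_space)
next
  case (Cons a u)
  interpret prob_space M using proc by (simp add: q_bernoulli_process_def)
  define n' where "n' = length u"
  have n: "n = Suc n'" using Cons n'_def by simp
  \<comment> \<open>The law of the process conditions on \<open>X l = x l\<close> for a function \<open>x\<close>, so \<open>u\<close> is presented as a
    history.\<close>
  obtain x where x: "history x n' = u" using ex_history n'_def by blast
  define Q where "Q = (\<lambda>\<omega>. \<forall>l\<in>{1..<Suc n'}. X l \<omega> = x l)"
  have Q: "history (\<lambda>j. X j \<omega>) n' = u \<longleftrightarrow> Q \<omega>" for \<omega>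
    unfolding Q_def x[symmetric] history_eq_iff ..
  have IH: "\<P>(\<omega> in M. Q \<omega>) = weight q \<theta> u"
    using Cons n'_def unfolding Q[symmetric] by auto
  have eq: "\<P>(\<omega> in M. history (\<lambda>j. X j \<omega>) n = a # u) = \<P>(\<omega> in M. X (Suc n') \<omega> = a \<and> Q \<omega>)"
    unfolding n by (simp add: Q)
  show ?case
  proof (cases "\<P>(\<omega> in M. Q \<omega>) > 0")
    case False
    then have 0: "\<P>(\<omega> in M. Q \<omega>) = 0" by (simp add: not_less measure_le_0_iff)
    have "{\<omega> \<in> space M. Q \<omega>} \<in> sets M"
      unfolding Q[symmetric] by (rule history_measurable[OF proc])
    then have "\<P>(\<omega> in M. X (Suc n') \<omega> = a \<and> Q \<omega>) \<le> \<P>(\<omega> in M. Q \<omega>)"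
      by (intro finite_measure_mono) auto
    then have "\<P>(\<omega> in M. X (Suc n') \<omega> = a \<and> Q \<omega>) = 0"
      using 0 by (simp add: measure_le_0_iff)
    then show ?thesis using eq 0 IH by simp
  next
    case True
    have *: "\<P>(\<omega> in M. X (Suc n') \<omega> = 0 \<bar> Q \<omega>) = 1 - \<theta> * q ^ count_list u 0 \<and>
        \<P>(\<omega> in M. X (Suc n') \<omega> = 1 \<bar> Q \<omega>) = \<theta> * q ^ count_list u 0"
      using proc True card_zeros_history[of n' x] x
      unfolding q_bernoulli_process_def Q_def by simp
    have "\<P>(\<omega> in M. X (Suc n') \<omega> = a \<bar> Q \<omega>) =
        (if a = 0 then 1 - \<theta> * q ^ count_list u 0 else \<theta> * q ^ count_list u 0)"
    proof -
      have "a = 0 \<or> a = 1" using Cons by auto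
      then show ?thesis using * by auto
    qed
    then have "\<P>(\<omega> in M. X (Suc n') \<omega> = a \<and> Q \<omega>) =
       (if a = 0 then 1 - \<theta> * q ^ count_list u 0 else \<theta> * q ^ count_list u 0) * \<P>(\<omega> in M. Q \<omega>)"
      using True unfolding cond_prob_def by (simp add: divide_eq_eq)
    then show ?thesis using eq IH by simp
  qed
qed

lemma history_event_eq_UN:
  assumes proc: "q_bernoulli_process M X q \<theta>"
  shows "{\<omega> \<in> space M. P (history (\<lambda>j. X j \<omega>) n)} =
    (\<Union>w\<in>{w \<in> lists {0, 1}. length w = n \<and> P w}. {\<omega> \<in> space M. history (\<lambda>j. X j \<omega>) n = w})"
proof -
  have "history (\<lambda>j. X j \<omega>) n \<in> lists {0, 1}" if "\<omega> \<in> space M" for \<omega>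
  proof -
    have "X j \<omega> \<in> {0, 1}" if "j \<ge> 1" for j
    proof -
      have "X j \<in> measurable M (count_space {0, 1})"
        using proc that by (simp add: q_bernoulli_process_def)
      from measurable_space[OF this \<open>\<omega> \<in> space M\<close>] show ?thesis by simp
    qed
    then show ?thesis by (force simp: history_def in_lists_conv_set)
  qed
  then show ?thesis by auto
qed

lemma finite_binary_words: "finite {w \<in> lists {0, 1 :: nat}. length w = n \<and> P w}"
  by (rule finite_subset[OF _ finite_lists_length_eq[of "{0, 1}" n]]) auto

lemma history_event_measurable:
  assumes proc: "q_bernoulli_process M X q \<theta>"
  shows "{\<omega> \<in> space M. P (history (\<lambda>j. X j \<omega>) n)} \<in> sets M"
  unfolding history_event_eq_UN[OF proc]
  by (intro sets.finite_UN finite_binary_words history_measurable[OF proc])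

lemma prob_history_event:
  assumes proc: "q_bernoulli_process M X q \<theta>"
  shows "\<P>(\<omega> in M. P (history (\<lambda>j. X j \<omega>) n)) =
    (\<Sum>w\<in>{w \<in> lists {0, 1}. length w = n \<and> P w}. weight q \<theta> w)"
proof -
  interpret prob_space M using proc by (simp add: q_bernoulli_process_def)
  let ?W = "{w \<in> lists {0, 1}. length w = n \<and> P w}"
  have "\<P>(\<omega> in M. P (history (\<lambda>j. X j \<omega>) n)) =
      (\<Sum>w\<in>?W. \<P>(\<omega> in M. history (\<lambda>j. X j \<omega>) n = w))"
    unfolding history_event_eq_UN[OF proc]
    by (intro finite_measure_finite_Union finite_binary_words)
      (auto simp: disjoint_family_on_def history_measurable[OF proc])
  also have "\<dots> = (\<Sum>w\<in>?W. weight q \<theta> w)"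
    by (intro sum.cong refl prob_history[OF proc]) auto
  finally show ?thesis .
qed

section \<open>Words with short runs\<close>

text \<open>The parameters come in pairs, \<open>k\<close> and \<open>m\<close> (bound on the runs and number of occurrences) for the
letter \<open>c\<close>, and \<open>l\<close> and \<open>r\<close> for \<open>d\<close>.  Exchanging the roles of the letters is then an exchange of
arguments, and one block recursion serves successes and failures alike.  The excluded head \<open>c\<close> is
the letter of the block that is put in front next; the empty word is always allowed.\<close>
definition short_run_words :: "nat \<Rightarrow> nat \<Rightarrow> nat \<Rightarrow> nat \<Rightarrow> nat \<Rightarrow> nat \<Rightarrow> nat list set" where
  "short_run_words k l c d m r = {u \<in> lists {c, d}. run_free c k u \<and> run_free d l u \<and>
     count_list u c = m \<and> count_list u d = r \<and> (u = [] \<or> hd u \<noteq> c)}"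

lemma length_two_letters:
  "u \<in> lists {c, d} \<Longrightarrow> c \<noteq> d \<Longrightarrow> length u = count_list u c + count_list u d"
  by (induction u) auto

lemma finite_short_run_words: "c \<noteq> d \<Longrightarrow> finite (short_run_words k l c d m r)"
  by (rule finite_subset[OF _ finite_lists_length_eq[of "{c, d}" "m + r"]])
    (auto simp: short_run_words_def length_two_letters in_lists_conv_set)

lemma count_list_replicate: "count_list (replicate b d) c = (if c = d then b else 0)"
  by (induction b) auto

text \<open>The first block of the list consists of letters \<open>d\<close>; removing it leaves a word that does not start
with \<open>d\<close>, which is a word of the same kind with the two letters exchanged.\<close>
lemma strip_block_bij:
  assumes cd: "c \<noteq> d" and k: "k \<ge> 1" and l: "l \<ge> 1"
  shows "bij_betw (\<lambda>(b, v). replicate b d @ v)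
    (SIGMA b:{b \<in> {0<..<l}. b \<le> r}. short_run_words l k d c (r - b) m)
    (short_run_words k l c d m r - {[]})"
proof (rule bij_betwI[where g = "\<lambda>u. (length (takeWhile ((=) d) u), dropWhile ((=) d) u)"])
  show "(\<lambda>(b, v). replicate b d @ v) \<in>
      (SIGMA b:{b \<in> {0<..<l}. b \<le> r}. short_run_words l k d c (r - b) m) \<rightarrow>
      short_run_words k l c d m r - {[]}"
    using cd k l
    by (auto simp: short_run_words_def run_free_replicate_other run_free_replicate_same
        count_list_replicate hd_append in_lists_conv_set 
        run_free_replicate_other[where u = "[]", simplified]
        run_free_replicate_same[where u = "[]", simplified])
next
  show "(\<lambda>u. (length (takeWhile ((=) d) u), dropWhile ((=) d) u)) \<in>
      short_run_words k l c d m r - {[]} \<rightarrow>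
      (SIGMA b:{b \<in> {0<..<l}. b \<le> r}. short_run_words l k d c (r - b) m)"
  proof
    fix u assume u: "u \<in> short_run_words k l c d m r - {[]}"
    define b where "b = length (takeWhile ((=) d) u)"
    define v where "v = dropWhile ((=) d) u"
    have tw: "takeWhile ((=) d) u = replicate b d"
      unfolding b_def by (rule replicate_length_same[symmetric]) (auto dest: set_takeWhileD)
    have uv: "u = replicate b d @ v"
      unfolding tw[symmetric] v_def by simp
    have v: "v = [] \<or> hd v \<noteq> d"
      unfolding v_def using hd_dropWhile[of "(=) d" u] by metis
    have "b > 0"
    proof (cases u)
      case (Cons a u')
      then have "a = d" using u by (auto simp: short_run_words_def)
      then show ?thesis using Cons by (simp add: b_def)
    qed (use u in auto)
    then have "(b, v) \<in> (SIGMA b:{b \<in> {0<..<l}. b \<le> r}. short_run_words l k d c (r - b) m)"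
      using u v cd k l unfolding uv
      by (auto simp: short_run_words_def run_free_replicate_other run_free_replicate_same
        count_list_replicate in_lists_conv_set)
    then show "(length (takeWhile ((=) d) u), dropWhile ((=) d) u) \<in>
        (SIGMA b:{b \<in> {0<..<l}. b \<le> r}. short_run_words l k d c (r - b) m)"
      by (simp add: b_def v_def)
  qed
next
  fix p assume "p \<in> (SIGMA b:{b \<in> {0<..<l}. b \<le> r}. short_run_words l k d c (r - b) m)"
  then obtain b v where p: "p = (b, v)" and v: "v = [] \<or> hd v \<noteq> d"
    by (auto simp: short_run_words_def)
  have "takeWhile ((=) d) v = []" "dropWhile ((=) d) v = v" using v by (cases v; auto)+
  then have "takeWhile ((=) d) (replicate b d @ v) = replicate b d"
    "dropWhile ((=) d) (replicate b d @ v) = v"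
    by (induction b) auto
  then show "(length (takeWhile ((=) d) (case p of (b, v) \<Rightarrow> replicate b d @ v)),
      dropWhile ((=) d) (case p of (b, v) \<Rightarrow> replicate b d @ v)) = p"
    unfolding p by simp
next
  fix u assume "u \<in> short_run_words k l c d m r - {[]}"
  have "replicate (length (takeWhile ((=) d) u)) d = takeWhile ((=) d) u"
    by (rule replicate_length_same) (auto dest: set_takeWhileD)
  then show "(case (length (takeWhile ((=) d) u), dropWhile ((=) d) u) of
      (b, v) \<Rightarrow> replicate b d @ v) = u" by simp
qed

lemma sum_short_run_words_strip:
  fixes f :: "nat list \<Rightarrow> real"
  assumes cd: "c \<noteq> d" and k: "k \<ge> 1" and l: "l \<ge> 1"
  shows "(\<Sum>u\<in>short_run_words k l c d m r. f u) = (if m = 0 \<and> r = 0 then f [] else 0) +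
    (\<Sum>b\<in>{b \<in> {0<..<l}. b \<le> r}. \<Sum>v\<in>short_run_words l k d c (r - b) m. f (replicate b d @ v))"
proof -
  let ?S = "short_run_words k l c d m r"
  have fin: "finite ?S" by (rule finite_short_run_words[OF cd])
  have nil: "[] \<in> ?S \<longleftrightarrow> m = 0 \<and> r = 0" by (auto simp: short_run_words_def)
  have "(\<Sum>u\<in>?S. f u) = (if m = 0 \<and> r = 0 then f [] else 0) + (\<Sum>u\<in>?S - {[]}. f u)"
    using fin nil by (auto simp: sum.remove)
  also have "(\<Sum>u\<in>?S - {[]}. f u) =
     (\<Sum>(b, v)\<in>(SIGMA b:{b \<in> {0<..<l}. b \<le> r}. short_run_words l k d c (r - b) m).
        f (replicate b d @ v))"
    using sum.reindex_bij_betw[OF strip_block_bij[OF assms, of r m], of f]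
    by (simp add: case_prod_unfold)
  also have "\<dots> = (\<Sum>b\<in>{b \<in> {0<..<l}. b \<le> r}.
      \<Sum>v\<in>short_run_words l k d c (r - b) m. f (replicate b d @ v))"
    by (rule sum.Sigma[symmetric]) (use cd in \<open>auto intro: finite_short_run_words\<close>)
  finally show ?thesis .
qed

text \<open>Stated for an arbitrary letter \<open>c\<close> so that it covers both waiting times; \<open>i\<close> is the number of
letters \<open>d\<close>.\<close>
lemma prob_completed_run:
  assumes proc: "q_bernoulli_process M X q \<theta>"
    and cd: "{c, d} = {0, 1}" and k: "k \<ge> 1" and l: "l \<ge> 1" and n: "k \<le> n"
  shows "\<P>(\<omega> in M. first_run c k (\<lambda>j. X j \<omega>) = enat n \<and>
        enat n < first_run d l (\<lambda>j. X j \<omega>)) =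
    (\<Sum>i=0..n - k. \<Sum>u\<in>short_run_words k l c d (n - k - i) i. weight q \<theta> (replicate k c @ u))"
proof -
  have ne: "c \<noteq> d" using cd by force
  define N where "N = n - k"
  obtain n' where n': "n = Suc n'" using n k by (cases n) auto
  define P where "P = (\<lambda>w. \<exists>u. w = replicate k c @ u \<and> run_free c k u \<and> run_free d l u \<and>
      (u = [] \<or> hd u \<noteq> c))"
  have P: "first_run c k x = enat n \<and> enat n < first_run d l x \<longleftrightarrow> P (history x n)" for x
    unfolding n' P_def first_run_eq_iff[OF k] first_run_gt_iff[OF l] history_Suc
      completed_run_iff[OF ne k l, symmetric] by blast
  let ?U = "\<Union>i\<in>{0..N}. short_run_words k l c d (N - i) i"
  have words: "{w \<in> lists {0, 1}. length w = n \<and> P w} = (\<lambda>u. replicate k c @ u) ` ?U"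
  proof (intro equalityI subsetI)
    fix w assume "w \<in> {w \<in> lists {0, 1}. length w = n \<and> P w}"
    then obtain u where w': "w \<in> lists {c, d}" "length w = n" and
      w: "w = replicate k c @ u" and u: "run_free c k u" "run_free d l u" "u = [] \<or> hd u \<noteq> c"
      unfolding P_def cd by blast
    have u': "u \<in> lists {c, d}" "length u = N"
      using w' w by (auto simp: N_def in_lists_conv_set)
    have "u \<in> short_run_words k l c d (N - count_list u d) (count_list u d)"
      "count_list u d \<in> {0..N}"
      using u u' length_two_letters[OF u'(1) ne] by (auto simp: short_run_words_def)
    then show "w \<in> (\<lambda>u. replicate k c @ u) ` ?U" using w by blast
  next
    fix w assume "w \<in> (\<lambda>u. replicate k c @ u) ` ?U"
    then obtain i u where w: "w = replicate k c @ u" and i: "i \<le> N"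
      and u: "u \<in> short_run_words k l c d (N - i) i" by auto
    have u': "u \<in> lists {c, d}" using u by (auto simp: short_run_words_def)
    have "length u = N" using u i length_two_letters[OF u' ne] by (auto simp: short_run_words_def)
    moreover have "P w" using u w by (auto simp: P_def short_run_words_def)
    moreover have "w \<in> lists {0, 1}"
      unfolding w cd[symmetric] using u' by (auto simp: in_lists_conv_set)
    ultimately show "w \<in> {w \<in> lists {0, 1}. length w = n \<and> P w}"
      using w n by (simp add: N_def)
  qed
  have "\<P>(\<omega> in M. first_run c k (\<lambda>j. X j \<omega>) = enat n \<and> enat n < first_run d l (\<lambda>j. X j \<omega>)) =
      (\<Sum>w\<in>(\<lambda>u. replicate k c @ u) ` ?U. weight q \<theta> w)"
    unfolding P prob_history_event[OF proc] words ..
  also have "\<dots> = (\<Sum>u\<in>?U. weight q \<theta> (replicate k c @ u))"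
    by (subst sum.reindex) (auto simp: inj_on_def)
  also have "\<dots> = (\<Sum>i=0..N. \<Sum>u\<in>short_run_words k l c d (N - i) i. weight q \<theta> (replicate k c @ u))"
    by (rule sum.UNION_disjoint) (use ne finite_short_run_words in \<open>auto, auto simp: short_run_words_def\<close>)
  finally show ?thesis by (simp add: N_def)
qed

section \<open>Block recursions\<close>

text \<open>The index sets of the four sums are products of two sets of this kind, which allows one to peel off
the last block length of one letter while keeping the other tuple.\<close>
definition compositions :: "nat \<Rightarrow> nat \<Rightarrow> nat \<Rightarrow> (nat \<Rightarrow> nat) set" where
  "compositions k t m = {x \<in> {1..t} \<rightarrow>\<^sub>E {0<..<k}. (\<Sum>j=1..t. x j) = m}"

lemma finite_compositions: "finite (compositions k t m)"
  unfolding compositions_def by (rule finite_subset[OF _ finite_PiE[of "{1..t}" "\<lambda>_. {0<..<k}"]]) auto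

lemma compositions_0: "compositions k 0 m = (if m = 0 then {\<lambda>_. undefined} else {})"
  by (auto simp: compositions_def)

lemma compositions_empty: "m < t \<Longrightarrow> compositions k t m = {}"
proof -
  have "t \<le> m" if "x \<in> compositions k t m" for x
  proof -
    have "(\<Sum>j=1..t. 1) \<le> (\<Sum>j=1..t. x j)"
      using that by (intro sum_mono) (auto simp: compositions_def PiE_iff Suc_le_eq)
    then show ?thesis using that by (simp add: compositions_def)
  qed
  then show "m < t \<Longrightarrow> compositions k t m = {}" by fastforce
qed

lemma sum_compositions_Suc:
  fixes f :: "(nat \<Rightarrow> nat) \<Rightarrow> real"
  shows "(\<Sum>x\<in>compositions k (Suc t) m. f x) =
    (\<Sum>a\<in>{a \<in> {0<..<k}. a \<le> m}. \<Sum>x\<in>compositions k t (m - a). f (x(Suc t := a)))"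
proof -
  let ?S = "SIGMA a:{a \<in> {0<..<k}. a \<le> m}. compositions k t (m - a)"
  have "bij_betw (\<lambda>(a, x). x(Suc t := a)) ?S (compositions k (Suc t) m)"
  proof (rule bij_betwI[where g = "\<lambda>x. (x (Suc t), x(Suc t := undefined))"])
    show "(\<lambda>(a, x). x(Suc t := a)) \<in> ?S \<rightarrow> compositions k (Suc t) m"
      by (auto simp: compositions_def PiE_iff extensional_def)
    show "(\<lambda>x. (x (Suc t), x(Suc t := undefined))) \<in> compositions k (Suc t) m \<rightarrow> ?S"
      by (auto simp: compositions_def PiE_iff extensional_def)
  qed (auto simp: compositions_def PiE_iff extensional_def fun_eq_iff)
  from sum.reindex_bij_betw[OF this, of f, symmetric] show ?thesis
    by (simp add: sum.Sigma finite_compositions case_prod_unfold)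
qed

lemma pair_sum_compositions:
  "(\<Sum>(x, y)\<in>{(x, y). x \<in> {1..t} \<rightarrow>\<^sub>E {0<..<k1} \<and> y \<in> {1..t'} \<rightarrow>\<^sub>E {0<..<k2} \<and>
       (\<Sum>j=1..t. x j) = m \<and> (\<Sum>j=1..t'. y j) = r}. f x y) =
   (\<Sum>x\<in>compositions k1 t m. \<Sum>y\<in>compositions k2 t' r. f x y)"
  unfolding sum.cartesian_product
  by (rule sum.cong) (auto simp: compositions_def)

lemmas qA_compositions = qA_def[unfolded pair_sum_compositions]
lemmas qB_compositions = qB_def[unfolded pair_sum_compositions]
lemmas qC_compositions = qC_def[unfolded pair_sum_compositions]
lemmas qD_compositions = qD_def[unfolded pair_sum_compositions]

text \<open>For zero blocks, the sums \<open>B\<close> and \<open>D\<close> represent the empty word.  With these values the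
recursions below also hold for a single block.\<close>
lemma qB_0: "qB q k1 k2 m r 0 = (if m = 0 \<and> r = 0 then 1 else 0)"
  by (simp add: qB_compositions compositions_0)

lemma qD_0: "qD q k1 k2 m r 0 = (if m = 0 \<and> r = 0 then 1 else 0)"
  by (simp add: qD_compositions compositions_0)

text \<open>A final block of failures is followed by no success, so removing it leaves the exponent
unchanged.\<close>
lemma qA_Suc: "qA q k1 k2 m r (Suc s) = (\<Sum>b\<in>{b \<in> {0<..<k2}. b \<le> r}. qD q k1 k2 m (r - b) s)"
proof -
  have "qA q k1 k2 m r (Suc s) = (\<Sum>x\<in>compositions k1 s m. \<Sum>b\<in>{b \<in> {0<..<k2}. b \<le> r}.
      \<Sum>y\<in>compositions k2 s (r - b). q ^ (\<Sum>j=1..s. (\<Sum>l=1..j. y l) * x j))"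
    unfolding qA_compositions sum_compositions_Suc by simp
  then show ?thesis unfolding qD_compositions by (subst sum.swap) simp
qed

lemma qB_Suc:
  "qB q k1 k2 m r (Suc s) = (\<Sum>b\<in>{b \<in> {0<..<k2}. b \<le> r}. qC q k1 k2 m (r - b) (Suc s))"
proof -
  have e: "(\<Sum>j=2..Suc s. (\<Sum>l=1..j - 1. (y(Suc s := b)) l) * x j) =
      (\<Sum>j=2..Suc s. (\<Sum>l=1..j - 1. y l) * x j)" for x y :: "nat \<Rightarrow> nat" and b
    by (intro sum.cong refl arg_cong2[where f = "(*)"]) auto
  have "qB q k1 k2 m r (Suc s) = (\<Sum>x\<in>compositions k1 (Suc s) m. \<Sum>b\<in>{b \<in> {0<..<k2}. b \<le> r}.
      \<Sum>y\<in>compositions k2 s (r - b). q ^ (\<Sum>j=2..Suc s. (\<Sum>l=1..j - 1. y l) * x j))"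
    unfolding qB_compositions
    by (rule sum.cong[OF refl]) (simp only: sum_compositions_Suc e)
  then show ?thesis unfolding qC_compositions by (subst sum.swap) simp
qed

text \<open>All \<open>r\<close> failures precede a final block of \<open>a\<close> successes, so removing it lowers the exponent by
\<open>r * a\<close>.\<close>
lemma qC_Suc:
  "qC q k1 k2 m r (Suc s) = (\<Sum>a\<in>{a \<in> {0<..<k1}. a \<le> m}. q ^ (r * a) * qB q k1 k2 (m - a) r s)"
proof -
  have e: "q ^ (\<Sum>j=2..Suc s. (\<Sum>l=1..j - 1. y l) * (x(Suc s := a)) j) =
      q ^ (r * a) * q ^ (\<Sum>j=2..s. (\<Sum>l=1..j - 1. y l) * x j)"
    if "y \<in> compositions k2 s r" for x y a
  proof -
    have "(\<Sum>l=1..s. y l) = r" using that by (simp add: compositions_def)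
    moreover have "(\<Sum>j=2..s. (\<Sum>l=1..j - 1. y l) * (x(Suc s := a)) j) =
        (\<Sum>j=2..s. (\<Sum>l=1..j - 1. y l) * x j)"
      by (intro sum.cong) auto
    ultimately have "(\<Sum>j=2..Suc s. (\<Sum>l=1..j - 1. y l) * (x(Suc s := a)) j) =
        r * a + (\<Sum>j=2..s. (\<Sum>l=1..j - 1. y l) * x j)"
      by (cases s) auto
    then show ?thesis by (simp add: power_add)
  qed
  show ?thesis
    unfolding qC_compositions qB_compositions diff_Suc_1 sum_compositions_Suc sum_distrib_left
    by (intro sum.cong refl) (simp only: e)
qed

lemma qD_Suc:
  "qD q k1 k2 m r (Suc s) =
     (\<Sum>a\<in>{a \<in> {0<..<k1}. a \<le> m}. q ^ (r * a) * qA q k1 k2 (m - a) r (Suc s))"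
proof -
  have e: "q ^ (\<Sum>j=1..Suc s. (\<Sum>l=1..j. y l) * (x(Suc s := a)) j) =
      q ^ (r * a) * q ^ (\<Sum>j=1..s. (\<Sum>l=1..j. y l) * x j)"
    if "y \<in> compositions k2 (Suc s) r" for x y a
  proof -
    have "(\<Sum>l=1..Suc s. y l) = r" using that by (simp add: compositions_def)
    moreover have "(\<Sum>j=1..s. (\<Sum>l=1..j. y l) * (x(Suc s := a)) j) =
        (\<Sum>j=1..s. (\<Sum>l=1..j. y l) * x j)"
      by (intro sum.cong) auto
    moreover have "(\<Sum>j=1..Suc s. (\<Sum>l=1..j. y l) * (x(Suc s := a)) j) =
        (\<Sum>j=1..s. (\<Sum>l=1..j. y l) * (x(Suc s := a)) j) + (\<Sum>l=1..Suc s. y l) * a"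
      by simp
    ultimately show ?thesis by (simp add: power_add)
  qed
  show ?thesis
    unfolding qD_compositions qA_compositions diff_Suc_1 sum_distrib_left
    by (subst sum_compositions_Suc[where k = k1]) (intro sum.cong refl, simp only: e)
qed

text \<open>Blocks are nonempty, so there are at most as many blocks of a letter as occurrences of it.\<close>
lemma qA_eq_0: "r < s \<Longrightarrow> qA q k1 k2 m r s = 0"
  by (simp add: qA_compositions compositions_empty)

lemma qB_eq_0: "r < s \<Longrightarrow> qB q k1 k2 m r s = 0"
  by (simp add: qB_compositions compositions_empty)

lemma qC_eq_0: "m < s \<Longrightarrow> qC q k1 k2 m r s = 0"
  by (simp add: qC_compositions compositions_empty)

lemma qD_eq_0: "m < s \<Longrightarrow> qD q k1 k2 m r s = 0"
  by (simp add: qD_compositions compositions_empty)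

lemma inversions_replicate:
  "inversions (replicate b 0 @ u) = inversions u"
  "inversions (replicate a (Suc 0) @ u) = a * count_list u 0 + inversions u"
  by (induction a; induction b; simp add: count_list_replicate)+

text \<open>The recursion on words and the one on block sums have the same shape once the number of blocks
may range up to any \<open>N \<ge> m + r\<close>: a block removal lowers \<open>N\<close> by one for one of the two
summands only, and the surplus term of the other one vanishes.  The empty word is not counted by the
block sums with \<open>s \<ge> 1\<close>, which accounts for the separate term.\<close>
lemma sum_inversions_block_sums:
  assumes k: "k1 \<ge> 1" "k2 \<ge> 1" and "m + r \<le> N"
  shows "(\<Sum>u\<in>short_run_words k1 k2 1 0 m r. q ^ inversions u) =
      (if m = 0 \<and> r = 0 then 1 else 0) + (\<Sum>s=1..N. qA q k1 k2 m r s + qB q k1 k2 m r s)" (is "?A m r N")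
    and "(\<Sum>u\<in>short_run_words k2 k1 0 1 r m. q ^ inversions u) =
      (if m = 0 \<and> r = 0 then 1 else 0) + (\<Sum>s=1..N. qC q k1 k2 m r s + qD q k1 k2 m r s)" (is "?B m r N")
proof -
  have "?A m r N \<and> ?B m r N"
    using assms(3)
  proof (induction "m + r" arbitrary: m r N rule: less_induct)
    case less
    let ?\<delta> = "\<lambda>m r. if m = 0 \<and> r = 0 then 1 else 0 :: real"
    have shift: "(\<Sum>s=1..N. f s) = (\<Sum>s<N. f (Suc s))" for f :: "nat \<Rightarrow> real"
      by (simp add: sum.atLeast1_atMost_eq)
    \<comment> \<open>One summand is indexed from 0 and keeps its initial term, the other one from 1; its last term
      is surplus.\<close>
    have split: "(\<Sum>s<Suc N'. f s + g (Suc s)) = f 0 + (\<Sum>s=1..N'. f s + g s)"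
      if "g (Suc N') = 0" for f g :: "nat \<Rightarrow> real" and N'
    proof -
      have "(\<Sum>s<Suc N'. f s) = f 0 + (\<Sum>s=1..N'. f s)"
        by (simp only: sum.lessThan_Suc_shift sum.atLeast1_atMost_eq One_nat_def)
      moreover have "(\<Sum>s<Suc N'. g (Suc s)) = (\<Sum>s=1..N'. g s)"
        using that by (simp add: sum.atLeast1_atMost_eq)
      ultimately show ?thesis by (simp add: sum.distrib)
    qed
    have A: "?A m r N"
    proof -
      have "(\<Sum>v\<in>short_run_words k2 k1 0 1 (r - b) m. q ^ inversions (replicate b 0 @ v)) =
          (\<Sum>s<N. qD q k1 k2 m (r - b) s + qC q k1 k2 m (r - b) (Suc s))"
        if b: "0 < b" "b < k2" "b \<le> r" for b
      proof -
        obtain N' where N: "N = Suc N'" using b less.prems by (cases N) auto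
        have "(\<Sum>v\<in>short_run_words k2 k1 0 1 (r - b) m. q ^ inversions v) =
            ?\<delta> m (r - b) + (\<Sum>s=1..N'. qC q k1 k2 m (r - b) s + qD q k1 k2 m (r - b) s)"
          using less.hyps[of m "r - b" N'] b less.prems N by auto
        also have "\<dots> = (\<Sum>s<N. qD q k1 k2 m (r - b) s + qC q k1 k2 m (r - b) (Suc s))"
          unfolding N
          by (subst split) (use b less.prems N in \<open>auto simp: qD_0 qC_eq_0 add.commute\<close>)
        finally show ?thesis by (simp add: inversions_replicate)
      qed
      then have "(\<Sum>u\<in>short_run_words k1 k2 1 0 m r. q ^ inversions u) = ?\<delta> m r +
          (\<Sum>b\<in>{b \<in> {0<..<k2}. b \<le> r}.
             \<Sum>s<N. qD q k1 k2 m (r - b) s + qC q k1 k2 m (r - b) (Suc s))"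
        by (subst sum_short_run_words_strip) (use k in auto)
      also have "(\<Sum>b\<in>{b \<in> {0<..<k2}. b \<le> r}.
             \<Sum>s<N. qD q k1 k2 m (r - b) s + qC q k1 k2 m (r - b) (Suc s)) =
          (\<Sum>s=1..N. qA q k1 k2 m r s + qB q k1 k2 m r s)"
        unfolding shift qA_Suc qB_Suc sum.distrib[symmetric] by (rule sum.swap)
      finally show ?thesis .
    qed
    have B: "?B m r N"
    proof -
      have "(\<Sum>v\<in>short_run_words k1 k2 1 0 (m - a) r. q ^ inversions (replicate a 1 @ v)) =
          (\<Sum>s<N. q ^ (r * a) * qB q k1 k2 (m - a) r s +
            q ^ (r * a) * qA q k1 k2 (m - a) r (Suc s))"
        if a: "0 < a" "a < k1" "a \<le> m" for a
      proof -
        obtain N' where N: "N = Suc N'" using a less.prems by (cases N) auto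
        have "(\<Sum>v\<in>short_run_words k1 k2 1 0 (m - a) r. q ^ inversions v) =
            ?\<delta> (m - a) r + (\<Sum>s=1..N'. qA q k1 k2 (m - a) r s + qB q k1 k2 (m - a) r s)"
          using less.hyps[of "m - a" r N'] a less.prems N by auto
        also have "\<dots> = (\<Sum>s<N. qB q k1 k2 (m - a) r s + qA q k1 k2 (m - a) r (Suc s))"
          unfolding N
          by (subst split) (use a less.prems N in \<open>auto simp: qB_0 qA_eq_0 add.commute\<close>)
        finally have *: "(\<Sum>v\<in>short_run_words k1 k2 1 0 (m - a) r. q ^ inversions v) =
          (\<Sum>s<N. qB q k1 k2 (m - a) r s + qA q k1 k2 (m - a) r (Suc s))" .
        have "(\<Sum>v\<in>short_run_words k1 k2 1 0 (m - a) r. q ^ inversions (replicate a 1 @ v)) =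
            (\<Sum>v\<in>short_run_words k1 k2 1 0 (m - a) r. q ^ (r * a) * q ^ inversions v)"
          by (intro sum.cong refl)
            (auto simp: inversions_replicate power_add short_run_words_def mult.commute)
        then show ?thesis
          unfolding sum_distrib_left[symmetric] distrib_left[symmetric] * .
      qed
      then have "(\<Sum>u\<in>short_run_words k2 k1 0 1 r m. q ^ inversions u) = ?\<delta> m r +
          (\<Sum>a\<in>{a \<in> {0<..<k1}. a \<le> m}. \<Sum>s<N. q ^ (r * a) * qB q k1 k2 (m - a) r s +
            q ^ (r * a) * qA q k1 k2 (m - a) r (Suc s))"
        by (subst sum_short_run_words_strip) (use k in auto)
      also have "(\<Sum>a\<in>{a \<in> {0<..<k1}. a \<le> m}. \<Sum>s<N. q ^ (r * a) * qB q k1 k2 (m - a) r s +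
            q ^ (r * a) * qA q k1 k2 (m - a) r (Suc s)) =
          (\<Sum>s=1..N. qC q k1 k2 m r s + qD q k1 k2 m r s)"
        unfolding shift qC_Suc qD_Suc sum.distrib[symmetric] by (rule sum.swap)
      finally show ?thesis .
    qed
    show ?case using A B by blast
  qed
  then show "?A m r N" "?B m r N" by blast+
qed

lemma weight_append_success_run:
  assumes "u \<in> short_run_words k1 k2 1 0 m r"
  shows "weight q \<theta> (replicate k 1 @ u) = \<theta> ^ (k + m) * q ^ (r * k) *
    (\<Prod>j=1..r. 1 - \<theta> * q ^ (j - 1)) * q ^ inversions u"
proof -
  have "replicate k 1 @ u \<in> lists {0, 1}"
    using assms by (auto simp: short_run_words_def in_lists_conv_set)
  from weight_eq[OF this] show ?thesis
    using assms
    by (simp add: short_run_words_def count_list_replicate inversions_replicate power_add mult_ac)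
qed

lemma weight_append_failure_run:
  assumes "u \<in> short_run_words k2 k1 0 1 r m"
  shows "weight q \<theta> (replicate k 0 @ u) = \<theta> ^ m *
    (\<Prod>j=1..r + k. 1 - \<theta> * q ^ (j - 1)) * q ^ inversions u"
proof -
  have "replicate k 0 @ u \<in> lists {0, 1}"
    using assms by (auto simp: short_run_words_def in_lists_conv_set)
  from weight_eq[OF this] show ?thesis
    using assms
    by (simp add: short_run_words_def count_list_replicate inversions_replicate add.commute)
qed

text \<open>The closing run of \<open>k1\<close> successes comes after all \<open>i\<close> failures, hence the factor \<open>q\<^sup>i\<^sup>k\<^sup>1\<close>.  The
extra \<open>1\<close> for \<open>n = k1\<close> is the empty word before the closing run.\<close>
lemma fS1_eq:
  assumes "q_bernoulli_process M X q \<theta>" and k: "k1 \<ge> 1" "k2 \<ge> 1" and n: "k1 \<le> n"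
  shows "fS1 M X k1 k2 n = (\<Sum>i=0..n - k1. \<theta> ^ (n - i) * q ^ (i * k1) *
    (\<Prod>j=1..i. 1 - \<theta> * q ^ (j - 1)) * ((if n = k1 then 1 else 0) +
       (\<Sum>s=1..i. qA q k1 k2 (n - k1 - i) i s + qB q k1 k2 (n - k1 - i) i s)))"
proof -
  have "(\<Sum>u\<in>short_run_words k1 k2 1 0 (n - k1 - i) i. weight q \<theta> (replicate k1 1 @ u)) =
      \<theta> ^ (n - i) * q ^ (i * k1) * (\<Prod>j=1..i. 1 - \<theta> * q ^ (j - 1)) *
      ((if n = k1 then 1 else 0) +
        (\<Sum>s=1..i. qA q k1 k2 (n - k1 - i) i s + qB q k1 k2 (n - k1 - i) i s))"
    if i: "i \<le> n - k1" for i
  proof -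
    have e: "k1 + (n - k1 - i) = n - i" using i n by simp
    \<comment> \<open>The common bound \<open>n - k1\<close> on the number of blocks can be lowered to \<open>i\<close>, since each of the
      \<open>s\<close> failure blocks is nonempty.\<close>
    have "(\<Sum>s=1..n - k1. qA q k1 k2 (n - k1 - i) i s + qB q k1 k2 (n - k1 - i) i s) =
        (\<Sum>s=1..i. qA q k1 k2 (n - k1 - i) i s + qB q k1 k2 (n - k1 - i) i s)"
      by (rule sum.mono_neutral_right) (use i in \<open>auto simp: qA_eq_0 qB_eq_0\<close>)
    moreover have "n - k1 - i = 0 \<and> i = 0 \<longleftrightarrow> n = k1" using n i by auto
    ultimately have "(\<Sum>u\<in>short_run_words k1 k2 1 0 (n - k1 - i) i. q ^ inversions u) =
        (if n = k1 then 1 else 0) +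
        (\<Sum>s=1..i. qA q k1 k2 (n - k1 - i) i s + qB q k1 k2 (n - k1 - i) i s)"
      using sum_inversions_block_sums(1)[OF k, of "n - k1 - i" i "n - k1"] i by simp
    then show ?thesis
      by (simp only: weight_append_success_run e sum_distrib_left[symmetric] cong: sum.cong)
  qed
  then show ?thesis
    unfolding fS1_def T1_def T0_def
    by (subst prob_completed_run[OF assms(1) _ k n]) auto
qed

text \<open>The closing failures come after all successes, so they only lengthen the product.  Here
\<open>prob_completed_run\<close> sums over the number of successes, and the sum has to be reversed.\<close>
lemma fS0_eq:
  assumes "q_bernoulli_process M X q \<theta>" and k: "k1 \<ge> 1" "k2 \<ge> 1" and n: "k2 \<le> n"
  shows "fS0 M X k1 k2 n = (\<Sum>i=0..n - k2. \<theta> ^ (n - k2 - i) *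
    (\<Prod>j=1..i + k2. 1 - \<theta> * q ^ (j - 1)) * ((if n = k2 then 1 else 0) +
       (\<Sum>s=1..n - k2 - i. qC q k1 k2 (n - k2 - i) i s + qD q k1 k2 (n - k2 - i) i s)))"
proof -
  have "(\<Sum>u\<in>short_run_words k2 k1 0 1 (n - k2 - i') i'. weight q \<theta> (replicate k2 0 @ u)) =
      \<theta> ^ (n - k2 - i) * (\<Prod>j=1..i + k2. 1 - \<theta> * q ^ (j - 1)) *
      ((if n = k2 then 1 else 0) +
        (\<Sum>s=1..n - k2 - i. qC q k1 k2 (n - k2 - i) i s + qD q k1 k2 (n - k2 - i) i s))"
    if i: "i' \<le> n - k2" "i = n - k2 - i'" for i i'
  proof -
    have e: "n - k2 - i' = i" "i' = n - k2 - i" "i \<le> n - k2" using i n by auto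
    have "(\<Sum>s=1..n - k2. qC q k1 k2 (n - k2 - i) i s + qD q k1 k2 (n - k2 - i) i s) =
        (\<Sum>s=1..n - k2 - i. qC q k1 k2 (n - k2 - i) i s + qD q k1 k2 (n - k2 - i) i s)"
      by (rule sum.mono_neutral_right) (use i in \<open>auto simp: qC_eq_0 qD_eq_0\<close>)
    moreover have "n - k2 - i = 0 \<and> i = 0 \<longleftrightarrow> n = k2" using n e by auto
    ultimately have "(\<Sum>u\<in>short_run_words k2 k1 0 1 i (n - k2 - i). q ^ inversions u) =
        (if n = k2 then 1 else 0) +
        (\<Sum>s=1..n - k2 - i. qC q k1 k2 (n - k2 - i) i s + qD q k1 k2 (n - k2 - i) i s)"
      using sum_inversions_block_sums(2)[OF k, of "n - k2 - i" i "n - k2"] e(3) by simp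
    then show ?thesis
      unfolding e(1) e(2)[symmetric]
      by (simp only: weight_append_failure_run sum_distrib_left[symmetric] cong: sum.cong)
  qed
  then have "(\<Sum>i'=0..n - k2. \<Sum>u\<in>short_run_words k2 k1 0 1 (n - k2 - i') i'.
        weight q \<theta> (replicate k2 0 @ u)) =
      (\<Sum>i'=0..n - k2. (\<lambda>i. \<theta> ^ (n - k2 - i) * (\<Prod>j=1..i + k2. 1 - \<theta> * q ^ (j - 1)) *
      ((if n = k2 then 1 else 0) +
        (\<Sum>s=1..n - k2 - i. qC q k1 k2 (n - k2 - i) i s + qD q k1 k2 (n - k2 - i) i s)))
          (n - k2 - i'))"
    by (intro sum.cong refl) simp
  also have "\<dots> = (\<Sum>i=0..n - k2. \<theta> ^ (n - k2 - i) * (\<Prod>j=1..i + k2. 1 - \<theta> * q ^ (j - 1)) *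
      ((if n = k2 then 1 else 0) +
        (\<Sum>s=1..n - k2 - i. qC q k1 k2 (n - k2 - i) i s + qD q k1 k2 (n - k2 - i) i s)))"
    by (subst sum.atLeastAtMost_rev) simp
  finally show ?thesis
    unfolding fS0_def T1_def T0_def
    by (subst prob_completed_run[OF assms(1) _ k(2,1) n]) auto
qed

text \<open>The two waiting times cannot both equal \<open>n\<close>, since the \<open>n\<close>-th trial would be a success and a
failure.\<close>
lemma fS_eq_fS1_plus_fS0:
  assumes proc: "q_bernoulli_process M X q \<theta>" and k: "k1 \<ge> 1" "k2 \<ge> 1" and n: "n \<ge> 1"
  shows "fS M X k1 k2 n = fS1 M X k1 k2 n + fS0 M X k1 k2 n"
proof -
  interpret prob_space M using proc by (simp add: q_bernoulli_process_def)
  obtain n' where n': "n = Suc n'" using n by (cases n) auto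
  obtain k1' k2' where k': "k1 = Suc k1'" "k2 = Suc k2'" using k by (cases k1; cases k2) auto
  let ?E = "\<lambda>c k d l. {\<omega> \<in> space M. first_run c k (\<lambda>j. X j \<omega>) = enat n \<and>
      enat n < first_run d l (\<lambda>j. X j \<omega>)}"
  have no_tie: "\<not> (first_run 1 k1 x = enat n \<and> first_run 0 k2 x = enat n)" for x
    unfolding n' first_run_eq_iff[OF k(1)] first_run_eq_iff[OF k(2)] by (simp add: k')
  have E: "?E c k d l \<in> sets M" if "k \<ge> 1" "l \<ge> 1" for c k d l
    unfolding n' first_run_eq_iff[OF that(1)] first_run_gt_iff[OF that(2)]
    using history_event_measurable[OF proc, of
        "\<lambda>w. run_free c k (tl w) \<and> take k w = replicate k c \<and> run_free d l w" n]
    by (simp add: n' conj_assoc del: take_Suc_Cons)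
  have "{\<omega> \<in> space M. WS X k1 k2 \<omega> = enat n} = ?E 1 k1 0 k2 \<union> ?E 0 k2 1 k1"
    using no_tie by (auto simp: WS_def T1_def T0_def min_def not_le order_le_less)
  moreover have "?E 1 k1 0 k2 \<inter> ?E 0 k2 1 k1 = {}"
    using no_tie by auto
  ultimately show ?thesis
    unfolding fS_def fS1_def fS0_def T1_def T0_def
    using finite_measure_Union[OF E[OF k] E[OF k(2,1)]] by simp
qed

theorem theorem3p1:
  fixes M :: "'a measure" and X :: "nat \<Rightarrow> 'a \<Rightarrow> nat" and q \<theta> :: real and k1 k2 :: nat
  assumes "0 \<le> \<theta>" and "\<theta> \<le> 1" and "0 < q" and "q < 1"
    and "k1 \<ge> 1" and "k2 \<ge> 1"
    and "q_bernoulli_process M X q \<theta>"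
  shows "(\<forall>n\<ge>min k1 k2. fS M X k1 k2 n = fS1 M X k1 k2 n + fS0 M X k1 k2 n) \<and>
    fS1 M X k1 k2 k1 = \<theta> ^ k1 \<and>
    fS0 M X k1 k2 k2 = (\<Prod>j=1..k2. 1 - \<theta> * q ^ (j - 1)) \<and>
    (\<forall>n>k1. fS1 M X k1 k2 n =
       (\<Sum>i=1..n - k1. \<theta> ^ (n - i) * q ^ (i * k1) * (\<Prod>j=1..i. 1 - \<theta> * q ^ (j - 1)) *
          (\<Sum>s=1..i. qA q k1 k2 (n - k1 - i) i s + qB q k1 k2 (n - k1 - i) i s))) \<and>
    (\<forall>n>k2. fS0 M X k1 k2 n =
       (\<Sum>i=0..n - k2. \<theta> ^ (n - k2 - i) * (\<Prod>j=1..i + k2. 1 - \<theta> * q ^ (j - 1)) *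
          (\<Sum>s=1..n - k2 - i. qC q k1 k2 (n - k2 - i) i s + qD q k1 k2 (n - k2 - i) i s)))"
proof -
  note proc = assms(7) and k = assms(5,6)
  have "fS1 M X k1 k2 k1 = \<theta> ^ k1"
    using fS1_eq[OF proc k, of k1] by simp
  moreover have "fS0 M X k1 k2 k2 = (\<Prod>j=1..k2. 1 - \<theta> * q ^ (j - 1))"
    using fS0_eq[OF proc k, of k2] by simp
  moreover have "fS1 M X k1 k2 n =
       (\<Sum>i=1..n - k1. \<theta> ^ (n - i) * q ^ (i * k1) * (\<Prod>j=1..i. 1 - \<theta> * q ^ (j - 1)) *
          (\<Sum>s=1..i. qA q k1 k2 (n - k1 - i) i s + qB q k1 k2 (n - k1 - i) i s))"
    if "n > k1" for n
    using fS1_eq[OF proc k, of n] that by (simp add: sum.atLeast_Suc_atMost)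
  moreover have "fS0 M X k1 k2 n =
       (\<Sum>i=0..n - k2. \<theta> ^ (n - k2 - i) * (\<Prod>j=1..i + k2. 1 - \<theta> * q ^ (j - 1)) *
          (\<Sum>s=1..n - k2 - i. qC q k1 k2 (n - k2 - i) i s + qD q k1 k2 (n - k2 - i) i s))"
    if "n > k2" for n
    using fS0_eq[OF proc k, of n] that by simp
  moreover have "fS M X k1 k2 n = fS1 M X k1 k2 n + fS0 M X k1 k2 n" if "n \<ge> min k1 k2" for n
    using fS_eq_fS1_plus_fS0[OF proc k, of n] that k by simp
  ultimately show ?thesis by blast
qed

end
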